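(* Let $d\ge 1$ be an integer and let $a,b$ be positive integers. For an integer $n\ge 0$ let $\mathcal{Q}_{a,b,d}(n)$ be the quantization function of the generalized Hirzebruch fibrations, i.e. the number of integer points of the polytope $\Delta^d_{a,b,n}$. Then for all $n\in\mathbb{N}$, $$\sum_{k=0}^{d+1}(-1)^k\binom{d+1}{k}\,\mathcal{Q}_{a,b,d}(n+d+1-k)=0.$$
   Context: For integers $d\ge1$, $a,b\ge 1$, $n\ge 0$, $$\Delta^d_{a,b,n}=\Big\{(x_1,\dots,x_{d+1})\in\mathbb{R}^{d+1}\ \Big|\ x_i\ge 0\ (1\le i\le d+1),\ \sum_{i=1}^d x_i\le a+n(b-x_{d+1}),\ x_{d+1}\le b\Big\},$$ and the quantization function is $$\mathcal{Q}_{a,b,d}(n):=\#\big(\Delta^d_{a,b,n}\cap\mathbb{Z}^{d+1}\big)=\sum_{i=0}^{b}\binom{a+d+ni}{d}.$$ (It is the dimension of the geometric quantization of the symplectic toric manifold $\mathrm{Proj}(\mathcal{O}\oplus\mathcal{O}(-n))\to\mathbb{CP}^d$ with Kähler form determined by $a,b$.) *)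

theory Defs
  imports "HOL-Analysis.Analysis"
begin

text \<open>
  A point \<open>(x\<^sub>1, \<dots>, x\<^sub>m)\<close> of \<open>R\<^sup>m\<close> is an extensional function on \<open>{1..m}\<close> (it takes the value
  \<open>undefined\<close> outside \<open>{1..m}\<close>). Extensionality makes the function determined by its coordinates,
  so that counting such functions counts points.
\<close>

definition real_space :: "nat \<Rightarrow> (nat \<Rightarrow> real) set" where
  "real_space m = ({1..m} \<rightarrow>\<^sub>E UNIV)"

definition integer_lattice :: "nat \<Rightarrow> (nat \<Rightarrow> real) set" where
  "integer_lattice m = ({1..m} \<rightarrow>\<^sub>E \<int>)"

definition hirzebruch_polytope :: "nat \<Rightarrow> nat \<Rightarrow> nat \<Rightarrow> nat \<Rightarrow> (nat \<Rightarrow> real) set" where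
  "hirzebruch_polytope d a b n =
    {x \<in> real_space (d + 1).
       (\<forall>i\<in>{1..d + 1}. 0 \<le> x i) \<and>
       (\<Sum>i=1..d. x i) \<le> real a + real n * (real b - x (d + 1)) \<and>
       x (d + 1) \<le> real b}"

definition quantization :: "nat \<Rightarrow> nat \<Rightarrow> nat \<Rightarrow> nat \<Rightarrow> nat" where
  "quantization a b d n = card (hirzebruch_polytope d a b n \<inter> integer_lattice (d + 1))"

text \<open>The counted set is finite, so \<^const>\<open>card\<close> is the actual number of lattice points.\<close>

lemma finite_hirzebruch_lattice_points:
  "finite (hirzebruch_polytope d a b n \<inter> integer_lattice (d + 1))"
proof (rule finite_subset)
  let ?B = "real a + real n * real b + real b"
  show "finite ({1..d + 1} \<rightarrow>\<^sub>E {t \<in> \<int>. \<bar>t\<bar> \<le> ?B})"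
    by (intro finite_PiE finite_abs_int_segment) simp
  show "hirzebruch_polytope d a b n \<inter> integer_lattice (d + 1)
      \<subseteq> {1..d + 1} \<rightarrow>\<^sub>E {t \<in> \<int>. \<bar>t\<bar> \<le> ?B}"
  proof
    fix x assume x: "x \<in> hirzebruch_polytope d a b n \<inter> integer_lattice (d + 1)"
    have nonneg: "0 \<le> x i" if "i \<in> {1..d + 1}" for i
      using x that unfolding hirzebruch_polytope_def by blast
    have base: "(\<Sum>i=1..d. x i) \<le> real a + real n * (real b - x (d + 1))"
      and last: "x (d + 1) \<le> real b"
      using x unfolding hirzebruch_polytope_def by blast+
    have "real n * (real b - x (d + 1)) \<le> real n * real b"
      using nonneg[of "d + 1"] by (intro mult_left_mono) auto
    with base have sum_le: "(\<Sum>i=1..d. x i) \<le> real a + real n * real b"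
      by linarith
    have "\<bar>x i\<bar> \<le> ?B" if i: "i \<in> {1..d + 1}" for i
    proof (cases "i = d + 1")
      case True
      have "0 \<le> real a + real n * real b" by simp
      with last nonneg[OF i] show ?thesis unfolding True by linarith
    next
      case False
      have "x i \<le> (\<Sum>i=1..d. x i)"
        using i False by (intro member_le_sum nonneg) auto
      with sum_le nonneg[OF i] show ?thesis by simp
    qed
    with x show "x \<in> {1..d + 1} \<rightarrow>\<^sub>E {t \<in> \<int>. \<bar>t\<bar> \<le> ?B}"
      unfolding integer_lattice_def by (auto simp: PiE_iff)
  qed
qed

end

theory Submission
  imports Defs
begin

text \<open>
  Slicing the polytope at \<open>x\<^sub>d\<^sub>+\<^sub>1 = b - j\<close> and adding a slack coordinate turns the lattice points
  into compositions, so that \<open>Q n = (\<Sum>j\<le>b. (a + n j + d choose d))\<close>. By Pascal's rule one forward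
  difference in \<open>n\<close> of \<open>(c + n j choose d + 1)\<close> is the sum of the functions \<open>(c + t + n j choose d)\<close>
  over \<open>t < j\<close>, so \<open>d + 1\<close> differences annihilate \<open>Q\<close>.
\<close>

text \<open>For the shift operator \<open>E\<close> this is
  \<open>(E - 1)^(m+1) = (E - 1)^m (E - 1)\<close>: Pascal's rule splits each coefficient, and the
  two halves recombine into differences of \<open>f\<close>.\<close>

lemma alternating_binomial_sum_Suc:
  fixes f :: "nat \<Rightarrow> int"
  shows "(\<Sum>k\<le>Suc m. (-1) ^ k * int (Suc m choose k) * f (n + Suc m - k))
    = (\<Sum>k\<le>m. (-1) ^ k * int (m choose k) * (f (Suc (n + m - k)) - f (n + m - k)))"
proof -
  have pascal: "int (Suc m choose Suc k) = int (m choose k) + int (m choose Suc k)" for k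
    by simp
  have "(\<Sum>k\<le>Suc m. (-1) ^ k * int (Suc m choose k) * f (n + Suc m - k))
      = f (n + Suc m) + (\<Sum>k\<le>m. - ((-1) ^ k * int (m choose k) * f (n + m - k)))
        + (\<Sum>k\<le>m. (-1) ^ Suc k * int (m choose Suc k) * f (n + Suc m - Suc k))"
    unfolding sum.atMost_Suc_shift pascal add.assoc sum.distrib[symmetric]
    by (simp add: algebra_simps del: binomial_Suc_Suc)
  also have "f (n + Suc m) + (\<Sum>k\<le>m. - ((-1) ^ k * int (m choose k) * f (n + m - k)))
        + (\<Sum>k\<le>m. (-1) ^ Suc k * int (m choose Suc k) * f (n + Suc m - Suc k))
      = (\<Sum>k\<le>Suc m. (-1) ^ k * int (m choose k) * f (n + Suc m - k))
        - (\<Sum>k\<le>m. (-1) ^ k * int (m choose k) * f (n + m - k))"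
    unfolding sum.atMost_Suc_shift by (simp add: sum_negf)
  \<comment> \<open>The term \<open>k = Suc m\<close> has coefficient 0; for \<open>k\<close> at
    most \<open>m\<close>, \<open>n + Suc m - k\<close> is \<open>Suc (n + m - k)\<close>.\<close>
  also have "(\<Sum>k\<le>Suc m. (-1) ^ k * int (m choose k) * f (n + Suc m - k))
      = (\<Sum>k\<le>m. (-1) ^ k * int (m choose k) * f (Suc (n + m - k)))"
    by (simp add: Suc_diff_le)
  finally show ?thesis
    by (simp add: sum_subtractf right_diff_distrib)
qed

text \<open>Pascal's rule, telescoped over the \<open>i\<close> unit steps from \<open>c\<close> to
  \<open>c + i\<close>.\<close>

lemma binomial_add_left_diff:
  "int (c + i choose Suc d) - int (c choose Suc d) = (\<Sum>j<i. int (c + j choose d))"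
  by (induction i) auto

text \<open>Induction on \<open>d\<close>: one difference lowers the lower index by one. The offset
  \<open>c\<close> must vary, since the induction hypothesis is applied at each
  \<open>c + j\<close>.\<close>

lemma alternating_binomial_sum_choose_eq_0:
  "(\<Sum>k\<le>Suc d. (-1) ^ k * int (Suc d choose k) * int (c + (n + Suc d - k) * i choose d)) = 0"
proof (induction d arbitrary: c)
  case 0
  then show ?case by simp
next
  case (Suc d)
  have "(\<Sum>k\<le>Suc (Suc d). (-1) ^ k * int (Suc (Suc d) choose k)
            * int (c + (n + Suc (Suc d) - k) * i choose Suc d))
      = (\<Sum>k\<le>Suc d. (-1) ^ k * int (Suc d choose k)
          * (int (c + Suc (n + Suc d - k) * i choose Suc d)
             - int (c + (n + Suc d - k) * i choose Suc d)))"
    by (rule alternating_binomial_sum_Suc)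
  \<comment> \<open>Since \<open>Suc N * i = N * i + i\<close>, each difference moves the upper
    index by \<open>i\<close>.\<close>
  also have "\<dots> = (\<Sum>k\<le>Suc d. (-1) ^ k * int (Suc d choose k)
          * (\<Sum>j<i. int (c + j + (n + Suc d - k) * i choose d)))"
    using binomial_add_left_diff[of "c + (n + Suc d - k) * i" i d for k]
    by (simp add: ac_simps del: binomial_Suc_Suc sum.atMost_Suc)
  also have "\<dots> = (\<Sum>j<i. \<Sum>k\<le>Suc d. (-1) ^ k * int (Suc d choose k)
          * int (c + j + (n + Suc d - k) * i choose d))"
    unfolding sum_distrib_left by (rule sum.swap)
  finally show ?case
    using Suc.IH by simp
qed

text \<open>The last entry of the list is the slack of the inequality for \<open>x\<^sub>1 + \<dots> + x\<^sub>d\<close>.\<close>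

lemma bij_betw_hirzebruch_lattice_points:
  "bij_betw (\<lambda>(j, l). \<lambda>i\<in>{1..d + 1}. if i = d + 1 then real (b - j) else real (l ! (i - 1)))
     (SIGMA j:{..b}. {l. length l = d + 1 \<and> sum_list l = a + n * j})
     (hirzebruch_polytope d a b n \<inter> integer_lattice (d + 1))"
  (is "bij_betw ?f ?A ?B")
proof -
  \<comment> \<open>The inverse map restores the slack as the appended entry. Its truncated
    subtractions are exact on \<open>?B\<close> by \<open>last_le\<close> and \<open>sum_le\<close>
    below.\<close>
  define g :: "(nat \<Rightarrow> real) \<Rightarrow> nat \<times> nat list" where
    "g x = (let j = b - nat \<lfloor>x (d + 1)\<rfloor>; l = map (\<lambda>i. nat \<lfloor>x (Suc i)\<rfloor>) [0..<d]
      in (j, l @ [a + n * j - sum_list l]))" for x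
  have sum_shift: "(\<Sum>i=1..d. h i) = (\<Sum>i<d. h (Suc i))" for h :: "nat \<Rightarrow> real"
    by (simp only: One_nat_def sum.atLeast1_atMost_eq)
  show ?thesis
  proof (rule bij_betw_byWitness[where f' = g])
    show "\<forall>p\<in>?A. g (?f p) = p"
    proof
      fix p assume "p \<in> ?A"
      then obtain j l where p: "p = (j, l)"
        and j: "j \<le> b" and len: "length l = d + 1" and sum: "sum_list l = a + n * j"
        by auto
      have l: "l = take d l @ [l ! d]"
        using len take_Suc_conv_app_nth[of d l] by simp
      have "map (\<lambda>i. nat \<lfloor>?f (j, l) (Suc i)\<rfloor>) [0..<d] = take d l"
        using len by (intro nth_equalityI) auto
      moreover have "b - nat \<lfloor>?f (j, l) (d + 1)\<rfloor> = j"
        using j by (simp del: of_nat_diff)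
      moreover have "a + n * j - sum_list (take d l) = l ! d"
        using sum arg_cong[OF l, of sum_list] by simp
      ultimately show "g (?f p) = p"
        unfolding p g_def Let_def by (simp only: l[symmetric])
    qed
    have coord: "x i \<in> \<int> \<and> 0 \<le> x i" if "x \<in> ?B" "i \<in> {1..d + 1}" for x i
      using that unfolding hirzebruch_polytope_def integer_lattice_def by (auto simp: PiE_iff)
    \<comment> \<open>Rounding loses nothing, as the coordinates are nonnegative integers.\<close>
    have nat_coord: "real (nat \<lfloor>x i\<rfloor>) = x i" if "x \<in> ?B" "i \<in> {1..d + 1}" for x i
      using coord[OF that] by (auto elim!: Ints_cases)
    have sum_le: "sum_list (map (\<lambda>i. nat \<lfloor>x (Suc i)\<rfloor>) [0..<d]) \<le> a + n * (b - nat \<lfloor>x (d + 1)\<rfloor>)"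
      and last_le: "nat \<lfloor>x (d + 1)\<rfloor> \<le> b" if x: "x \<in> ?B" for x
    proof -
      have le: "x (d + 1) \<le> real b"
        and base: "(\<Sum>i=1..d. x i) \<le> real a + real n * (real b - x (d + 1))"
        using x unfolding hirzebruch_polytope_def by blast+
      show last: "nat \<lfloor>x (d + 1)\<rfloor> \<le> b"
        using le nat_coord[OF x, of "d + 1"] by simp
      have "real (sum_list (map (\<lambda>i. nat \<lfloor>x (Suc i)\<rfloor>) [0..<d])) = (\<Sum>i<d. real (nat \<lfloor>x (Suc i)\<rfloor>))"
        by (simp add: interv_sum_list_conv_sum_set_nat atLeast0LessThan)
      also have "\<dots> = (\<Sum>i=1..d. x i)"
        unfolding sum_shift using nat_coord[OF x] by (intro sum.cong) auto
      also have "\<dots> \<le> real (a + n * (b - nat \<lfloor>x (d + 1)\<rfloor>))"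
        using base nat_coord[OF x, of "d + 1"] last by (simp add: of_nat_diff)
      finally show "sum_list (map (\<lambda>i. nat \<lfloor>x (Suc i)\<rfloor>) [0..<d]) \<le> a + n * (b - nat \<lfloor>x (d + 1)\<rfloor>)"
        by linarith
    qed
    show "\<forall>x\<in>?B. ?f (g x) = x"
    proof
      fix x assume x: "x \<in> ?B"
      show "?f (g x) = x"
      proof (rule extensionalityI)
        show "?f (g x) \<in> extensional {1..d + 1}"
          by (simp add: g_def Let_def)
        show "x \<in> extensional {1..d + 1}"
          using x unfolding integer_lattice_def by (auto simp: PiE_def)
        fix i assume i: "i \<in> {1..d + 1}"
        show "?f (g x) i = x i"
          using i nat_coord[OF x i] last_le[OF x]
          by (auto simp: g_def Let_def nth_append)
      qed
    qed
    show "?f ` ?A \<subseteq> ?B"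
    proof (rule image_subsetI)
      fix p assume "p \<in> ?A"
      then obtain j l where p: "p = (j, l)"
        and j: "j \<le> b" and len: "length l = d + 1" and sum: "sum_list l = a + n * j"
        by auto
      \<comment> \<open>Dropping the slack \<open>l ! d\<close> turns the equation into the facet
        inequality.\<close>
      have "(\<Sum>i<d. l ! i) \<le> a + n * j"
        using len sum by (simp add: sum_list_sum_nth atLeast0LessThan)
      then have "(\<Sum>i<d. real (l ! i)) \<le> real a + real n * real j"
        by (metis of_nat_add of_nat_mult of_nat_le_iff of_nat_sum)
      then have "(\<Sum>i=1..d. ?f (j, l) i) \<le> real a + real n * real j"
        unfolding sum_shift by simp
      then show "?f p \<in> ?B"
        using j by (auto simp: p hirzebruch_polytope_def real_space_def integer_lattice_def of_nat_diff)
    qed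
    show "g ` ?B \<subseteq> ?A"
      using sum_le by (auto simp: g_def Let_def)
  qed
qed

lemma quantization_eq_sum_binomial:
  "quantization a b d n = (\<Sum>j\<le>b. a + d + n * j choose d)"
proof -
  let ?L = "\<lambda>j. {l :: nat list. length l = d + 1 \<and> sum_list l = a + n * j}"
  \<comment> \<open>Stars and bars gives the lower index \<open>a + n * j\<close>; symmetry replaces
    it by \<open>d\<close>.\<close>
  have card_L: "card (?L j) = (a + d + n * j choose d)" for j
    using binomial_symmetric[of d "a + d + n * j"]
    by (simp add: card_length_sum_list ac_simps)
  \<comment> \<open>The binomial coefficient is positive, whereas an infinite set has
    \<open>card\<close> 0.\<close>
  have "finite (?L j)" for j
    using card_L[of j] by (intro card_ge_0_finite) simp
  then have "card (SIGMA j:{..b}. ?L j) = (\<Sum>j\<le>b. card (?L j))"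
    by simp
  then show ?thesis
    using bij_betw_same_card[OF bij_betw_hirzebruch_lattice_points[of d b a n]] card_L
    by (simp add: quantization_def)
qed

theorem proposition4:
  fixes d a b n :: nat
  assumes "d \<ge> 1" and "a \<ge> 1" and "b \<ge> 1"
  shows "(\<Sum>k=0..d + 1. (-1) ^ k * int ((d + 1) choose k)
            * int (quantization a b d (n + d + 1 - k))) = 0"
proof -
  have "(\<Sum>k=0..d + 1. (-1) ^ k * int ((d + 1) choose k)
            * int (quantization a b d (n + d + 1 - k)))
      = (\<Sum>k\<le>Suc d. \<Sum>j\<le>b. (-1) ^ k * int (Suc d choose k)
            * int (a + d + (n + Suc d - k) * j choose d))"
    by (simp add: quantization_eq_sum_binomial sum_distrib_left atLeast0AtMost
        del: binomial_Suc_Suc sum.atMost_Suc)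
  also have "\<dots> = (\<Sum>j\<le>b. \<Sum>k\<le>Suc d. (-1) ^ k * int (Suc d choose k)
            * int (a + d + (n + Suc d - k) * j choose d))"
    by (rule sum.swap)
  \<comment> \<open>Each slice \<open>j\<close> vanishes separately, with \<open>c = a + d\<close>
    and \<open>i = j\<close>.\<close>
  also have "\<dots> = 0"
    by (simp only: alternating_binomial_sum_choose_eq_0 sum.neutral_const)
  finally show ?thesis .
qed

end
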